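(* Misère Connect $k$, $k\ge 2$, played on a board of width $w<k$ is a draw under optimal play: each player has a strategy guaranteeing that they never connect $k$.
   Context: Misère Connect $k$ is played on a grid with $w\ge 1$ columns and $h\ge 1$ rows. Player 1 (P1) and Player 2 (P2) alternate turns, P1 first. On each turn the player selects a non-full column and their piece occupies the lowest empty cell of that column; a column is full after $h$ plays. A player connects $k$ when $k$ of their pieces occupy $k$ consecutive cells in a horizontal, vertical, or diagonal (either direction) line. The first player to connect $k$ loses. If the board fills with no player having connected $k$, the game is a draw. *)

theory Defs
  imports Main
begin

datatype player = P1 | P2

text \<open>A play is recorded as the chronological list of the columns chosen; columns are
  numbered from 0, and so are moves.\<close>

definition mover :: "nat \<Rightarrow> player" where
  "mover i = (if even i then P1 else P2)"

text \<open>A board maps each column to the pieces in it, listed from bottom to top.\<close>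

type_synonym board = "nat \<Rightarrow> player list"

definition board_of :: "nat list \<Rightarrow> board" where
  "board_of ms c = map mover (filter (\<lambda>i. ms ! i = c) [0..<length ms])"

text \<open>Cells (column, row) have integer coordinates, so that falling diagonals need no
  truncated subtraction.\<close>

definition occupies :: "board \<Rightarrow> player \<Rightarrow> int \<times> int \<Rightarrow> bool" where
  "occupies b p = (\<lambda>(x, y). 0 \<le> x \<and> 0 \<le> y \<and>
     nat y < length (b (nat x)) \<and> b (nat x) ! nat y = p)"

definition connects :: "nat \<Rightarrow> player \<Rightarrow> board \<Rightarrow> bool" where
  "connects k p b \<longleftrightarrow>
     (\<exists>x y. \<exists>(dx, dy) \<in> {(1, 0), (0, 1), (1, 1), (1, - 1)}.
        \<forall>i<k. occupies b p (x + int i * dx, y + int i * dy))"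

definition legal_moves :: "nat \<Rightarrow> nat \<Rightarrow> nat list \<Rightarrow> nat set" where
  "legal_moves w h ms = {c. c < w \<and> length (board_of ms c) < h}"

definition finished :: "nat \<Rightarrow> nat \<Rightarrow> nat \<Rightarrow> nat list \<Rightarrow> bool" where
  "finished k w h ms \<longleftrightarrow> (\<exists>p. connects k p (board_of ms)) \<or> legal_moves w h ms = {}"

inductive play :: "nat \<Rightarrow> nat \<Rightarrow> nat \<Rightarrow> nat list \<Rightarrow> bool" for k w h where
  start: "play k w h []"
| move: "play k w h ms \<Longrightarrow> \<not> finished k w h ms \<Longrightarrow> c \<in> legal_moves w h ms \<Longrightarrow>
    play k w h (ms @ [c])"

text \<open>A strategy may depend on the whole history of the play.\<close>

definition strategy :: "nat \<Rightarrow> nat \<Rightarrow> nat \<Rightarrow> player \<Rightarrow> (nat list \<Rightarrow> nat) \<Rightarrow> bool" where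
  "strategy k w h p \<sigma> \<longleftrightarrow>
     (\<forall>ms. play k w h ms \<and> \<not> finished k w h ms \<and> mover (length ms) = p \<longrightarrow>
        \<sigma> ms \<in> legal_moves w h ms)"

definition follows :: "player \<Rightarrow> (nat list \<Rightarrow> nat) \<Rightarrow> nat list \<Rightarrow> bool" where
  "follows p \<sigma> ms \<longleftrightarrow> (\<forall>i<length ms. mover i = p \<longrightarrow> ms ! i = \<sigma> (take i ms))"

lemma length_board_of_snoc:
  "length (board_of (ms @ [c]) d) = length (board_of ms d) + (if c = d then 1 else 0)"
proof -
  have "filter (\<lambda>i. (ms @ [c]) ! i = d) [0..<length ms] = filter (\<lambda>i. ms ! i = d) [0..<length ms]"
    by (rule filter_cong) (auto simp: nth_append)
  then show ?thesis
    by (simp add: board_of_def)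
qed

lemma empty_cells_decrease:
  assumes "c \<in> legal_moves w h ms"
  shows "(\<Sum>d<w. h - length (board_of (ms @ [c]) d)) < (\<Sum>d<w. h - length (board_of ms d))"
  by (rule sum_strict_mono_ex1)
    (use assms in \<open>auto simp: length_board_of_snoc legal_moves_def intro!: bexI[of _ c]\<close>)

text \<open>The value of a position under optimal play, by backward induction, as the payoff to P1:
  \<open>1\<close> if P1 wins, \<open>0\<close> for a draw, \<open>- 1\<close> if P2 wins.  In a play at most one player ever
  connects \<open>k\<close>, so the order of the first two tests does not matter there.\<close>

function optimal_value :: "nat \<Rightarrow> nat \<Rightarrow> nat \<Rightarrow> nat list \<Rightarrow> int" where
  "optimal_value k w h ms =
     (if connects k P1 (board_of ms) then - 1
      else if connects k P2 (board_of ms) then 1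
      else if legal_moves w h ms = {} then 0
      else if mover (length ms) = P1
        then Max ((\<lambda>c. optimal_value k w h (ms @ [c])) ` legal_moves w h ms)
        else Min ((\<lambda>c. optimal_value k w h (ms @ [c])) ` legal_moves w h ms))"
  by pat_completeness auto
termination
  by (relation "measure (\<lambda>(k, w, h, ms). \<Sum>d<w. h - length (board_of ms d))")
    (auto intro: empty_cells_decrease)

declare optimal_value.simps [simp del]

definition draw_under_optimal_play :: "nat \<Rightarrow> nat \<Rightarrow> nat \<Rightarrow> bool" where
  "draw_under_optimal_play k w h \<longleftrightarrow> optimal_value k w h [] = 0"

definition can_avoid_connecting :: "nat \<Rightarrow> nat \<Rightarrow> nat \<Rightarrow> player \<Rightarrow> bool" where
  "can_avoid_connecting k w h p \<longleftrightarrow>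
     (\<exists>\<sigma>. strategy k w h p \<sigma> \<and>
        (\<forall>ms. play k w h ms \<and> follows p \<sigma> ms \<longrightarrow> \<not> connects k p (board_of ms)))"

end

theory Submission
  imports Defs
begin

text \<open>On a board with fewer than \<open>k\<close> columns only a vertical line can contain \<open>k\<close> cells, so a
  player merely has to keep the runs of own pieces inside each column short.  The strategy is to
  play on top of an opponent's piece whenever some playable column shows one, and anywhere
  otherwise (\<open>reply\<close>).

  A move onto an opponent's piece only starts a run of length 1.  After each own move no playable
  column shows an opponent's piece, hence at the next turn one is missing only if the opponent has
  just filled a column (or at the very first move of the game).  So each move that may lengthen a
  run is paid for by a newly filled column.  Consequently, with \<open>f\<close> columns filled, all runs have
  length at most \<open>f + 1\<close>, and since the lengthening move itself needs a playable column, none is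
  ever longer than \<open>w\<close>, which is less than \<open>k\<close>.

  The invariant \<open>safe\<close> expresses this bookkeeping.  It survives every move of the opponent
  (\<open>safe_opponent\<close>) and the prescribed reply (\<open>safe_reply\<close>), and excludes a connection
  (\<open>safe_not_connects\<close>).  Induction along a play then shows that the strategy never connects, and
  backward induction bounds the optimal value from the side of each player, so that it is zero.\<close>

section \<open>Runs of equal pieces in a column\<close>

text \<open>Failure at an offset includes running past the end of the list, so that the starting point
  needs no bound.\<close>

definition runs_le :: "'a \<Rightarrow> nat \<Rightarrow> 'a list \<Rightarrow> bool" where
  "runs_le p n xs \<longleftrightarrow> (\<forall>y. \<exists>i\<le>n. \<not> (y + i < length xs \<and> xs ! (y + i) = p))"

lemma runs_le_Nil: "runs_le p n []"
  by (auto simp: runs_le_def)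

lemma runs_le_mono: "runs_le p m xs \<Longrightarrow> m \<le> n \<Longrightarrow> runs_le p n xs"
  unfolding runs_le_def by (meson le_trans)

lemma runs_le_snoc_other:
  assumes "runs_le p n xs" "q \<noteq> p"
  shows "runs_le p n (xs @ [q])"
  unfolding runs_le_def
proof
  fix y
  obtain i where "i \<le> n" "\<not> (y + i < length xs \<and> xs ! (y + i) = p)"
    using assms(1) unfolding runs_le_def by blast
  then show "\<exists>i\<le>n. \<not> (y + i < length (xs @ [q]) \<and> (xs @ [q]) ! (y + i) = p)"
    using assms(2) by (intro exI[of _ i]) (auto simp: nth_append)
qed

lemma runs_le_snoc:
  assumes "runs_le p n xs"
  shows "runs_le p (Suc n) (xs @ [q])"
  unfolding runs_le_def
proof
  fix y
  obtain i where i: "i \<le> n" "\<not> (y + i < length xs \<and> xs ! (y + i) = p)"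
    using assms unfolding runs_le_def by blast
  show "\<exists>i\<le>Suc n. \<not> (y + i < length (xs @ [q]) \<and> (xs @ [q]) ! (y + i) = p)"
  proof (cases "y + i < length xs")
    case True
    with i show ?thesis by (intro exI[of _ i]) (auto simp: nth_append)
  next
    case False
    with i show ?thesis by (intro exI[of _ "Suc i"]) auto
  qed
qed

lemma runs_le_snoc_new_run:
  assumes "runs_le p n xs" "xs \<noteq> []" "last xs \<noteq> p" "1 \<le> n"
  shows "runs_le p n (xs @ [q])"
  unfolding runs_le_def
proof
  fix y
  consider "length xs \<le> y" | "y < length xs" "length xs \<le> y + n" | "y + n < length xs"
    by linarith
  then show "\<exists>i\<le>n. \<not> (y + i < length (xs @ [q]) \<and> (xs @ [q]) ! (y + i) = p)"
  proof cases
    case 1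
    with assms show ?thesis by (intro exI[of _ 1]) auto
  next
    \<comment> \<open>the window contains the old last piece\<close>
    case 2
    with assms show ?thesis
      by (intro exI[of _ "length xs - 1 - y"]) (auto simp: nth_append last_conv_nth)
  next
    case 3
    obtain i where "i \<le> n" "\<not> (y + i < length xs \<and> xs ! (y + i) = p)"
      using assms(1) unfolding runs_le_def by blast
    with 3 show ?thesis by (intro exI[of _ i]) (auto simp: nth_append)
  qed
qed

section \<open>Moves and lines on a narrow board\<close>

lemma board_of_snoc:
  "board_of (ms @ [c]) =
    (board_of ms)(c := board_of ms c @ [mover (length ms)])"
proof
  fix d
  have "filter (\<lambda>i. (ms @ [c]) ! i = d) [0..<length ms] = filter (\<lambda>i. ms ! i = d) [0..<length ms]"
    by (rule filter_cong) (auto simp: nth_append)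
  then show "board_of (ms @ [c]) d =
      ((board_of ms)(c := board_of ms c @ [mover (length ms)])) d"
    by (simp add: board_of_def)
qed

lemma board_of_outside: "c \<notin> set ms \<Longrightarrow> board_of ms c = []"
  by (auto simp: board_of_def filter_empty_conv)

lemma legal_moves_subset: "legal_moves w h ms \<subseteq> {..<w}"
  by (auto simp: legal_moves_def)

lemma finite_legal_moves: "finite (legal_moves w h ms)"
  by (rule finite_subset[OF legal_moves_subset]) simp

lemma card_legal_moves: "card (legal_moves w h ms) \<le> w"
  using card_mono[OF _ legal_moves_subset, of w h ms] by simp

lemma legal_moves_snoc:
  "legal_moves w h (ms @ [c]) = legal_moves w h ms \<or>
   legal_moves w h (ms @ [c]) = legal_moves w h ms - {c}"
proof (cases "Suc (length (board_of ms c)) < h")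
  case True
  then have "legal_moves w h (ms @ [c]) = legal_moves w h ms"
    by (auto simp: legal_moves_def board_of_snoc)
  then show ?thesis ..
next
  case False
  then have "legal_moves w h (ms @ [c]) = legal_moves w h ms - {c}"
    by (auto simp: legal_moves_def board_of_snoc)
  then show ?thesis ..
qed

text \<open>A horizontal or diagonal line would meet \<open>k\<close> different columns.\<close>

lemma not_connects_narrow:
  assumes "set ms \<subseteq> {..<w}" "w < k" and runs: "\<And>c. runs_le p w (board_of ms c)"
  shows "\<not> connects k p (board_of ms)"
proof
  assume "connects k p (board_of ms)"
  then obtain x y dx dy where
    d: "(dx, dy) \<in> {(1, 0), (0, 1), (1, 1), (1, - 1 :: int)}" and
    occ: "\<And>i. i < k \<Longrightarrow> occupies (board_of ms) p (x + int i * dx, y + int i * dy)"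
    unfolding connects_def by (elim exE bexE) (simp only: split_paired_all case_prod_conv, blast)
  have first: "0 \<le> x" "0 \<le> y"
    using occ[of 0] assms(2) by (auto simp: occupies_def)
  from d consider "dx = 1" | "dx = 0" "dy = 1" by auto
  then show False
  proof cases
    case 1
    have "nat (x + int w) \<notin> set ms"
      using assms(1) first by force
    with occ[OF assms(2)] 1 board_of_outside show False
      by (auto simp: occupies_def)
  next
    case 2
    obtain i where i: "i \<le> w"
      "\<not> (nat y + i < length (board_of ms (nat x)) \<and> board_of ms (nat x) ! (nat y + i) = p)"
      using runs unfolding runs_le_def by blast
    have "nat (y + int i) = nat y + i" using first by simp
    with occ[of i] i 2 assms(2) show False by (auto simp: occupies_def)
  qed
qed

section \<open>The invariant of the strategy\<close>

definition filled :: "nat \<Rightarrow> nat \<Rightarrow> nat list \<Rightarrow> nat" where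
  "filled w h ms = w - card (legal_moves w h ms)"

definition exposed :: "player \<Rightarrow> nat \<Rightarrow> nat \<Rightarrow> nat list \<Rightarrow> nat set" where
  "exposed p w h ms =
    {c \<in> legal_moves w h ms. board_of ms c \<noteq> [] \<and> last (board_of ms c) \<noteq> p}"

definition reply :: "player \<Rightarrow> nat \<Rightarrow> nat \<Rightarrow> nat list \<Rightarrow> nat" where
  "reply p w h ms = (SOME c. c \<in>
    (if exposed p w h ms = {} then legal_moves w h ms else exposed p w h ms))"

text \<open>When it is the turn of \<open>p\<close> and no column is exposed, the sharper bound \<open>filled\<close> leaves room
  for one run to grow.  At most one column is exposed, because otherwise a single reply would not
  cover all of them.\<close>

definition safe :: "player \<Rightarrow> nat \<Rightarrow> nat \<Rightarrow> nat list \<Rightarrow> bool" where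
  "safe p w h ms \<longleftrightarrow> set ms \<subseteq> {..<w} \<and>
     (\<forall>c. runs_le p (min w (Suc (filled w h ms))) (board_of ms c)) \<and>
     (if mover (length ms) = p
      then (\<exists>c. exposed p w h ms \<subseteq> {c}) \<and>
        (exposed p w h ms = {} \<longrightarrow> (\<forall>c. runs_le p (filled w h ms) (board_of ms c)))
      else exposed p w h ms = {})"

lemma safe_Nil: "safe p w h []"
  by (simp add: safe_def exposed_def board_of_outside runs_le_Nil)

lemma safe_not_connects:
  assumes "safe p w h ms" "w < k"
  shows "\<not> connects k p (board_of ms)"
proof (rule not_connects_narrow[OF _ assms(2)])
  show "set ms \<subseteq> {..<w}"
    using assms(1) by (simp add: safe_def)
  have "runs_le p (min w (Suc (filled w h ms))) (board_of ms c)" for c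
    using assms(1) by (simp add: safe_def)
  then show "runs_le p w (board_of ms c)" for c
    by (rule runs_le_mono) simp
qed

lemma reply_in:
  assumes "legal_moves w h ms \<noteq> {}"
  shows "reply p w h ms \<in>
    (if exposed p w h ms = {} then legal_moves w h ms else exposed p w h ms)"
  unfolding reply_def by (rule someI_ex) (use assms in auto)

lemma reply_legal:
  "legal_moves w h ms \<noteq> {} \<Longrightarrow> reply p w h ms \<in> legal_moves w h ms"
  using reply_in[of w h ms p] by (auto simp: exposed_def split: if_splits)

lemma filled_snoc_ge: "filled w h ms \<le> filled w h (ms @ [c])"
proof -
  have "legal_moves w h (ms @ [c]) \<subseteq> legal_moves w h ms"
    using legal_moves_snoc[of w h ms c] by blast
  then show ?thesis
    unfolding filled_def by (intro diff_le_mono2 card_mono finite_legal_moves)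
qed

lemma filled_snoc_full:
  assumes "c \<in> legal_moves w h ms" "c \<notin> legal_moves w h (ms @ [c])"
  shows "filled w h (ms @ [c]) = Suc (filled w h ms)"
proof -
  have "legal_moves w h (ms @ [c]) = legal_moves w h ms - {c}"
    using legal_moves_snoc[of w h ms c] assms by auto
  moreover have "0 < card (legal_moves w h ms)"
    using assms(1) by (auto simp: card_gt_0_iff finite_legal_moves)
  ultimately show ?thesis
    using assms(1) finite_legal_moves card_legal_moves[of w h ms] by (simp add: filled_def)
qed

lemma filled_less: "c \<in> legal_moves w h ms \<Longrightarrow> filled w h ms < w"
proof -
  assume c: "c \<in> legal_moves w h ms"
  then have "0 < card (legal_moves w h ms)"
    by (auto simp: card_gt_0_iff finite_legal_moves)
  moreover have "0 < w" using c by (auto simp: legal_moves_def)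
  ultimately show ?thesis by (simp add: filled_def)
qed

lemma exposed_snoc:
  "exposed p w h (ms @ [c]) =
    (exposed p w h ms - {c}) \<union>
    (if c \<in> legal_moves w h (ms @ [c]) \<and> mover (length ms) \<noteq> p then {c} else {})"
proof -
  have "d \<in> legal_moves w h (ms @ [c]) \<longleftrightarrow> d \<in> legal_moves w h ms" if "d \<noteq> c" for d
    using legal_moves_snoc[of w h ms c] that by auto
  then show ?thesis by (auto simp: exposed_def board_of_snoc)
qed

lemma mover_Suc: "mover (Suc n) = p \<longleftrightarrow> mover n \<noteq> p"
  by (cases p) (auto simp: mover_def)

text \<open>An opponent's move lengthens no run of \<open>p\<close>: it either exposes its column or fills it, and the
  latter raises the bound \<open>filled\<close> to what was allowed before.\<close>

lemma safe_opponent: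
  assumes safe: "safe p w h ms" and "mover (length ms) \<noteq> p" and c: "c \<in> legal_moves w h ms"
  shows "safe p w h (ms @ [c])"
proof -
  let ?ms = "ms @ [c]"
  have w: "set ?ms \<subseteq> {..<w}"
    using safe c by (auto simp: safe_def legal_moves_def)
  have runs: "runs_le p (min w (Suc (filled w h ms))) (board_of ?ms d)" for d
    using safe assms(2) by (auto simp: safe_def board_of_snoc intro: runs_le_snoc_other)
  have exp: "exposed p w h ?ms = (if c \<in> legal_moves w h ?ms then {c} else {})"
    using safe assms(2) by (auto simp: safe_def exposed_snoc)
  have "runs_le p (min w (Suc (filled w h ?ms))) (board_of ?ms d)" for d
    by (rule runs_le_mono[OF runs]) (use filled_snoc_ge[of w h ms c] in auto)
  moreover have "runs_le p (filled w h ?ms) (board_of ?ms d)" if "exposed p w h ?ms = {}" for d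
    by (rule runs_le_mono[OF runs])
      (use that exp filled_snoc_full[OF c] in \<open>auto split: if_splits\<close>)
  ultimately show ?thesis
    using w exp assms(2) by (auto simp: safe_def mover_Suc)
qed

lemma safe_reply:
  assumes safe: "safe p w h ms" and m: "mover (length ms) = p" and "legal_moves w h ms \<noteq> {}"
  shows "safe p w h (ms @ [reply p w h ms])"
proof -
  define c where "c = reply p w h ms"
  let ?ms = "ms @ [c]"
  have c: "c \<in> legal_moves w h ms"
    unfolding c_def using assms(3) by (rule reply_legal)
  have w: "set ?ms \<subseteq> {..<w}"
    using safe c by (auto simp: safe_def legal_moves_def)
  have runs: "runs_le p (min w (Suc (filled w h ms))) (board_of ms d)" for d
    using safe by (auto simp: safe_def)
  have moved: "runs_le p (min w (Suc (filled w h ms))) (board_of ?ms d) \<and> exposed p w h ?ms = {}" for d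
  proof (cases "exposed p w h ms = {}")
    case True
    then have sharp: "runs_le p (filled w h ms) (board_of ms d)" for d
      using safe m by (auto simp: safe_def)
    \<comment> \<open>the column played in was not yet filled, so the longer run still fits into \<open>w\<close>\<close>
    have "min w (Suc (filled w h ms)) = Suc (filled w h ms)"
      using filled_less[OF c] by simp
    then show ?thesis
      using True m runs runs_le_snoc[OF sharp] by (auto simp: board_of_snoc exposed_snoc)
  next
    case False
    then have in_exposed: "c \<in> exposed p w h ms"
      using reply_in[OF assms(3), of p] by (simp add: c_def)
    then have "exposed p w h ms = {c}"
      using safe m by (auto simp: safe_def)
    then have "exposed p w h ?ms = {}"
      using m by (simp add: exposed_snoc)
    moreover have "runs_le p (min w (Suc (filled w h ms))) (board_of ms c @ [p])"
      using in_exposed filled_less[OF c]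
      by (intro runs_le_snoc_new_run[OF runs]) (auto simp: exposed_def)
    ultimately show ?thesis
      using m runs by (simp add: board_of_snoc)
  qed
  have "runs_le p (min w (Suc (filled w h ?ms))) (board_of ?ms d)" for d
    by (rule runs_le_mono[OF conjunct1[OF moved]]) (use filled_snoc_ge[of w h ms c] in auto)
  then have "safe p w h ?ms"
    using w m moved by (simp add: safe_def mover_Suc)
  then show ?thesis by (simp add: c_def)
qed

section \<open>Avoidance and the optimal value\<close>

lemma safe_play:
  assumes "play k w h ms" "follows p (reply p w h) ms"
  shows "safe p w h ms"
  using assms
proof induction
  case start
  show ?case by (rule safe_Nil)
next
  case (move ms c)
  have replies: "(ms @ [c]) ! i = reply p w h (take i (ms @ [c]))"
    if "i < Suc (length ms)" "mover i = p" for i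
    using move.prems that by (simp add: follows_def)
  have "ms ! i = reply p w h (take i ms)" if "i < length ms" "mover i = p" for i
    using replies[of i] that by (simp add: nth_append)
  then have safe: "safe p w h ms"
    by (intro move.IH) (simp add: follows_def)
  show ?case
  proof (cases "mover (length ms) = p")
    case True
    then have "c = reply p w h ms"
      using replies[of "length ms"] by simp
    moreover have "legal_moves w h ms \<noteq> {}"
      using move.hyps(3) by blast
    ultimately show ?thesis
      using safe_reply[OF safe True] by simp
  next
    case False
    from safe False move.hyps(3) show ?thesis by (rule safe_opponent)
  qed
qed

lemma can_avoid_connecting_narrow:
  assumes "w < k"
  shows "can_avoid_connecting k w h p"
  unfolding can_avoid_connecting_def
proof (intro exI conjI allI impI)
  show "strategy k w h p (reply p w h)"
    unfolding strategy_def finished_def using reply_legal by blast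
next
  fix ms assume "play k w h ms \<and> follows p (reply p w h) ms"
  with assms show "\<not> connects k p (board_of ms)"
    using safe_play safe_not_connects by blast
qed

lemma optimal_value_safe_P1:
  assumes "w < k" "safe P1 w h ms"
  shows "0 \<le> optimal_value k w h ms"
  using assms
proof (induction k w h ms rule: optimal_value.induct)
  case (1 k w h ms)
  note safe = \<open>safe P1 w h ms\<close>
  have no1: "\<not> connects k P1 (board_of ms)"
    using safe \<open>w < k\<close> by (rule safe_not_connects)
  show ?case
  proof (cases "connects k P2 (board_of ms) \<or> legal_moves w h ms = {}")
    case True
    with no1 show ?thesis by (auto simp: optimal_value.simps[of k w h ms])
  next
    case False
    show ?thesis
    proof (cases "mover (length ms) = P1")
      case True
      let ?c = "reply P1 w h ms"
      have c: "?c \<in> legal_moves w h ms"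
        using False by (intro reply_legal) simp
      have "safe P1 w h (ms @ [?c])"
        using safe True False by (intro safe_reply) simp_all
      then have "0 \<le> optimal_value k w h (ms @ [?c])"
        using no1 False True c \<open>w < k\<close> by (intro "1.IH"(1)) simp_all
      then show ?thesis
        using no1 False True c finite_legal_moves
        by (auto simp: optimal_value.simps[of k w h ms] Max_ge_iff)
    next
      case opp: False
      have "0 \<le> optimal_value k w h (ms @ [c])" if "c \<in> legal_moves w h ms" for c
        using no1 False opp that \<open>w < k\<close> safe_opponent[OF safe opp that]
        by (intro "1.IH"(2)) simp_all
      then show ?thesis
        using no1 False opp finite_legal_moves
        by (auto simp: optimal_value.simps[of k w h ms] Min_ge_iff)
    qed
  qed
qed

lemma optimal_value_safe_P2:
  assumes "w < k" "safe P2 w h ms"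
  shows "optimal_value k w h ms \<le> 0"
  using assms
proof (induction k w h ms rule: optimal_value.induct)
  case (1 k w h ms)
  note safe = \<open>safe P2 w h ms\<close>
  have no2: "\<not> connects k P2 (board_of ms)"
    using safe \<open>w < k\<close> by (rule safe_not_connects)
  show ?case
  proof (cases "connects k P1 (board_of ms) \<or> legal_moves w h ms = {}")
    case True
    with no2 show ?thesis by (auto simp: optimal_value.simps[of k w h ms])
  next
    case False
    show ?thesis
    proof (cases "mover (length ms) = P1")
      case True
      then have opp: "mover (length ms) \<noteq> P2" by simp
      have "optimal_value k w h (ms @ [c]) \<le> 0" if "c \<in> legal_moves w h ms" for c
        using no2 False True that \<open>w < k\<close> safe_opponent[OF safe opp that]
        by (intro "1.IH"(1)) simp_all
      then show ?thesis
        using no2 False True finite_legal_moves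
        by (auto simp: optimal_value.simps[of k w h ms] Max_le_iff)
    next
      case own: False
      then have P2: "mover (length ms) = P2" by (cases "mover (length ms)") auto
      let ?c = "reply P2 w h ms"
      have c: "?c \<in> legal_moves w h ms"
        using False by (intro reply_legal) simp
      have "safe P2 w h (ms @ [?c])"
        using safe P2 False by (intro safe_reply) simp_all
      then have "optimal_value k w h (ms @ [?c]) \<le> 0"
        using no2 False own c \<open>w < k\<close> by (intro "1.IH"(2)) simp_all
      then show ?thesis
        using no2 False own c finite_legal_moves
        by (auto simp: optimal_value.simps[of k w h ms] Min_le_iff)
    qed
  qed
qed

theorem mainTheorem8:
  fixes k w h :: nat
  assumes "k \<ge> 2" and "w \<ge> 1" and "h \<ge> 1" and "w < k"
  shows "draw_under_optimal_play k w h \<and>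
    can_avoid_connecting k w h P1 \<and> can_avoid_connecting k w h P2"
proof -
  have "optimal_value k w h [] = 0"
    using optimal_value_safe_P1[OF \<open>w < k\<close> safe_Nil] optimal_value_safe_P2[OF \<open>w < k\<close> safe_Nil]
    by (rule order_antisym[rotated])
  then show ?thesis
    using can_avoid_connecting_narrow[OF \<open>w < k\<close>] by (simp add: draw_under_optimal_play_def)
qed

end
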